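(* Let $k\ge 2$ and $a\ge 0$ be integers. The gap vector of $\mathcal{P}_{k,a}$ is given, for $i\ge 1$, by $$\gamma(\mathcal{P}_{k,a})_i=\begin{cases}0 & \text{if } i<k \text{ or } a-2<i,\\ (a-i-1)\binom{i+k-1}{2k-1} & \text{if } k\le i\le a-2.\end{cases}$$
   Context: Let $C_{2k}$ be the cycle with vertices $1,\dots,2k$ in cyclic order and edges $(i,i+1)$, $i=1,\dots,2k$, where $(2k,2k+1)$ means $(2k,1)$. For an edge $e$ let $V(e)\in\mathbb{Z}^{2k}$ be the vector with coordinates $V(e)_v=1$ if $v\in e$ and $V(e)_v=0$ otherwise. The polytope $\mathcal{P}_{k,a}$ is the convex hull in $\mathbb{Z}^{2k}\times\mathbb{Z}$ (tensored with the reals) of the points $(V(i,i+1),0)$, $(V(i,i+1),1)$ for $i=2,3,\dots,2k$, together with $(V(1,2),a)$ and $(V(1,2),a+1)$. For a lattice polytope $\mathcal{P}$ in a lattice $M$ (here $M=\mathbb{Z}^{2k}\times\mathbb{Z}$), let $\mathcal{C}\subset\mathbb{Z}\times M$ be the semigroup of lattice points in the real cone over $\{1\}\times\mathcal{P}$, with coordinate number $0$ being the first one. $Ehr_{\mathcal{P}}(j)$ is the number of points of $\mathcal{C}$ with zeroth coordinate $j$ (that is, the number of lattice points in $j\mathcal{P}$), and $H_{\mathcal{P}}(j)$ is the number of points with zeroth coordinate $j$ in the semigroup generated by the lattice points of $\{1\}\times\mathcal{P}$. The gap vector is $\gamma(\mathcal{P})_j:=Ehr_{\mathcal{P}}(j)-H_{\mathcal{P}}(j)$,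 $j\ge 1$. *)

theory Defs
  imports "HOL-Analysis.Analysis" "HOL-Analysis.Finite_Function_Topology"
begin

text \<open>
  A lattice is given as a subset \<open>M\<close> of a real vector space, which plays the role of the lattice
  tensored with the reals; the zeroth coordinate is the first component of a pair.
\<close>

definition cone_semigroup :: "'v::real_vector set \<Rightarrow> 'v set \<Rightarrow> (real \<times> 'v) set" where
  "cone_semigroup M P = (\<int> \<times> M) \<inter> (cone hull ({1} \<times> P))"

text \<open>
  Like the semigroup of all lattice points in the cone, the generated semigroup contains \<open>0\<close>;
  this is irrelevant in positive degrees.
\<close>

inductive_set generated_semigroup :: "'v::real_vector set \<Rightarrow> 'v set" for G where
  zero: "0 \<in> generated_semigroup G"
| gen: "x \<in> G \<Longrightarrow> x \<in> generated_semigroup G"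
| add: "x \<in> generated_semigroup G \<Longrightarrow> y \<in> generated_semigroup G \<Longrightarrow> x + y \<in> generated_semigroup G"

text \<open>
  If \<open>M\<close> is a lattice of finite rank and \<open>P\<close> is a polytope, then the sets whose cardinality
  is taken below are finite.
\<close>

definition Ehr :: "'v::real_vector set \<Rightarrow> 'v set \<Rightarrow> nat \<Rightarrow> nat" where
  "Ehr M P j = card {c \<in> cone_semigroup M P. fst c = real j}"

definition Hilb :: "'v::real_vector set \<Rightarrow> 'v set \<Rightarrow> nat \<Rightarrow> nat" where
  "Hilb M P j = card {c \<in> generated_semigroup ((\<int> \<times> M) \<inter> ({1} \<times> P)). fst c = real j}"

definition gap_vector :: "'v::real_vector set \<Rightarrow> 'v set \<Rightarrow> nat \<Rightarrow> int" where
  "gap_vector M P j = int (Ehr M P j) - int (Hilb M P j)"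

text \<open>
  Since \<open>k\<close> is a term variable, real vectors with coordinates \<open>1, \<dots>, 2k\<close> are represented as
  finitely supported functions on \<open>nat\<close> with support in \<open>{1..2 * k}\<close>.
\<close>

type_synonym space = "(nat \<Rightarrow>\<^sub>0 real) \<times> real"

definition cycle_lattice :: "nat \<Rightarrow> space set" where
  "cycle_lattice k =
     {x. Poly_Mapping.keys x \<subseteq> {1..2 * k} \<and> (\<forall>v. Poly_Mapping.lookup x v \<in> \<int>)} \<times> \<int>"

definition cycle_edge :: "nat \<Rightarrow> nat \<Rightarrow> nat set" where
  "cycle_edge k i = {i, if i = 2 * k then 1 else i + 1}"

definition edge_vector :: "nat set \<Rightarrow> (nat \<Rightarrow>\<^sub>0 real)" where
  "edge_vector e = (\<Sum>v\<in>e. Poly_Mapping.single v 1)"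

lemma lookup_edge_vector:
  "finite e \<Longrightarrow> Poly_Mapping.lookup (edge_vector e) v = (if v \<in> e then 1 else 0)"
  by (simp add: edge_vector_def lookup_sum lookup_single when_def)

definition cycle_polytope :: "nat \<Rightarrow> nat \<Rightarrow> space set" where
  "cycle_polytope k a = convex hull
     ((\<Union>i\<in>{2..2 * k}. {(edge_vector (cycle_edge k i), 0), (edge_vector (cycle_edge k i), 1)}) \<union>
      {(edge_vector (cycle_edge k 1), real a), (edge_vector (cycle_edge k 1), real a + 1)})"

end

theory Submission
  imports Defs
begin

text \<open>
  Write a point of the cone in degree \<open>j\<close> as a pair \<open>(\<Sum>\<^sub>i w\<^sub>i V(i,i+1), h)\<close> with real weights
  \<open>w\<^sub>i \<ge> 0\<close> of sum \<open>j\<close> and a height \<open>h\<close> with \<open>a w\<^sub>1 \<le> h \<le> a w\<^sub>1 + j\<close>; the generated semigroup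
  consists of the points that admit such a description with natural numbers \<open>w\<^sub>i\<close> and an integer
  \<open>h\<close>. Since the cycle is even, the weights are not unique: the relations between the edge vectors
  are spanned by the alternating vector, so the weights of a given vertex vector \<open>x\<close> form a segment
  in the direction \<open>(+,-,+,-,\<dots>)\<close>. If \<open>x\<close> is integral, all weights are integral as soon as
  \<open>w\<^sub>1\<close> is, and rounding \<open>w\<^sub>1\<close> down along this segment keeps every weight nonnegative, because an
  integer above \<open>-1\<close> is nonnegative.

  Over a given \<open>x\<close> the cone thus contains an interval of heights, while the semigroup only contains
  the union of the intervals \<open>[a t, a t + j]\<close> over the integers \<open>t\<close> that occur as \<open>w\<^sub>1\<close>. What is
  missing are the heights (\<open>a - j - 1\<close> of them, or none if this is negative) strictly between \<open>a t + j\<close> and \<open>a (t + 1)\<close>, once for each pair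
  \<open>t\<close>, \<open>t + 1\<close> of consecutive values of \<open>w\<^sub>1\<close> (\<open>real_slice_lattice_cases\<close>,
  \<open>lattice_point_not_generated\<close>, \<open>even_positive_point_in_real_slice\<close>). Passing from \<open>t\<close> to \<open>t + 1\<close>
  lowers the \<open>k\<close> even-numbered weights by one, so such pairs, for all \<open>x\<close> together, correspond to
  the natural weights of sum \<open>j\<close> whose even-numbered entries are positive. Subtracting one from
  these entries leaves the compositions of \<open>j - k\<close> into \<open>2 k\<close> natural parts, of which there are
  \<open>j + k - 1\<close> choose \<open>2 k - 1\<close> (\<open>card_even_positive\<close>). The same rounding argument in degree one,
  where no weights of this kind exist, identifies the generators.
\<close>

section \<open>Combinations of edge vectors\<close>

definition edge_comb :: "nat \<Rightarrow> (nat \<Rightarrow> real) \<Rightarrow> (nat \<Rightarrow>\<^sub>0 real)" where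
  "edge_comb k w = (\<Sum>i\<in>{1..2 * k}. w i *\<^sub>R edge_vector (cycle_edge k i))"

lemma lookup_scaleR: "Poly_Mapping.lookup (r *\<^sub>R x) v = r *\<^sub>R Poly_Mapping.lookup x v"
proof -
  have "finite {i. r *\<^sub>R Poly_Mapping.lookup x i \<noteq> 0}"
    by (rule finite_subset[OF _ finite_lookup[of x]]) auto
  then show ?thesis
    by (simp add: scaleR_poly_mapping_def Abs_poly_mapping_inverse)
qed

lemma lookup_edge_comb:
  assumes "k \<ge> 2"
  shows "Poly_Mapping.lookup (edge_comb k w) v =
    (if v = 1 then w 1 + w (2 * k) else if v \<in> {2..2 * k} then w (v - 1) + w v else 0)"
proof -
  have expand: "Poly_Mapping.lookup (edge_comb k w) v =
      (\<Sum>i\<in>{1..2 * k}. w i * (if v \<in> cycle_edge k i then 1 else 0))"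
    by (simp add: edge_comb_def lookup_sum lookup_scaleR lookup_edge_vector cycle_edge_def)
  show ?thesis
  proof (cases "v \<in> {1..2 * k}")
    case False
    then have "v \<notin> cycle_edge k i" if "i \<in> {1..2 * k}" for i
      using that by (auto simp: cycle_edge_def)
    then show ?thesis
      unfolding expand using False assms by auto
  next
    case True
    define u where "u = (if v = 1 then 2 * k else v - 1)"
    have u: "u \<in> {1..2 * k}"
      using True assms by (auto simp: u_def)
    have "(\<Sum>i\<in>{1..2 * k}. w i * (if v \<in> cycle_edge k i then 1 else 0)) =
        (\<Sum>i\<in>{1..2 * k}. (if i = v then w i else 0) + (if i = u then w i else 0))"
      using True assms by (intro sum.cong) (auto simp: cycle_edge_def u_def split: if_splits)
    also have "\<dots> = w v + w u"
      using True u by (simp add: sum.distrib)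
    finally show ?thesis
      unfolding expand using True by (auto simp: u_def)
  qed
qed

lemma edge_comb_cong:
  "(\<And>i. i \<in> {1..2 * k} \<Longrightarrow> w i = w' i) \<Longrightarrow> edge_comb k w = edge_comb k w'"
  by (simp add: edge_comb_def)

lemma edge_comb_add: "edge_comb k (\<lambda>i. w i + w' i) = edge_comb k w + edge_comb k w'"
  by (simp add: edge_comb_def scaleR_left_distrib sum.distrib)

lemma edge_comb_scale: "edge_comb k (\<lambda>i. r * w i) = r *\<^sub>R edge_comb k w"
  by (simp add: edge_comb_def scaleR_sum_right)

lemma edge_comb_delta:
  assumes "i \<in> {1..2 * k}"
  shows "edge_comb k (\<lambda>l. if l = i then 1 else 0) = edge_vector (cycle_edge k i)"
  using assms by (simp add: edge_comb_def if_distrib[of "\<lambda>r. r *\<^sub>R _"] cong: if_cong)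

text \<open>
  The sign is chosen so that \<open>alt_shift r\<close> lowers the weight of the first edge by \<open>r\<close>.
\<close>

definition alt_shift :: "real \<Rightarrow> (nat \<Rightarrow> real) \<Rightarrow> nat \<Rightarrow> real" where
  "alt_shift r w i = (if odd i then w i - r else w i + r)"

lemma edge_comb_alt_shift:
  assumes "k \<ge> 2"
  shows "edge_comb k (alt_shift r w) = edge_comb k w"
  by (rule poly_mapping_eqI) (auto simp: lookup_edge_comb[OF assms] alt_shift_def)

lemma sum_alternating:
  fixes k :: nat and r :: real
  shows "(\<Sum>i\<in>{1..2 * k}. if odd i then r else - r) = 0"
  by (induction k) auto

lemma sum_alt_shift: "sum (alt_shift r w) {1..2 * k} = sum w {1..2 * k}"
proof -
  have "sum (alt_shift r w) {1..2 * k} = (\<Sum>i\<in>{1..2 * k}. w i - (if odd i then r else - r))"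
    by (intro sum.cong) (auto simp: alt_shift_def)
  then show ?thesis
    using sum_alternating[of r k] by (simp add: sum_subtractf)
qed

text \<open>
  Neighbouring weights sum to the coordinate at their common vertex, so the first weight
  determines all the others. This is the same induction that yields integrality below.
\<close>

lemma edge_comb_eq_imp_alt_shift:
  assumes "k \<ge> 2" "edge_comb k w = edge_comb k w'" "i \<in> {1..2 * k}"
  shows "w' i = alt_shift (w 1 - w' 1) w i"
proof -
  have "1 \<le> i" using assms by simp
  then show ?thesis
    using assms(3)
  proof (induction rule: dec_induct)
    case base
    then show ?case by (simp add: alt_shift_def)
  next
    case (step m)
    have "Poly_Mapping.lookup (edge_comb k w) (Suc m) = Poly_Mapping.lookup (edge_comb k w') (Suc m)"
      using assms by simp
    then have "w m + w (Suc m) = w' m + w' (Suc m)"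
      using step by (auto simp: lookup_edge_comb[OF assms(1)])
    then show ?case
      using step by (auto simp: alt_shift_def split: if_splits)
  qed
qed

text \<open>
  Rounding the first weight to an integer makes all weights integral if the vertex vector is.
\<close>

lemma integral_edge_comb_imp_alt_shift:
  assumes "k \<ge> 2" "\<And>v. Poly_Mapping.lookup (edge_comb k w) v \<in> \<int>"
    and "w 1 - r \<in> \<int>" "i \<in> {1..2 * k}"
  shows "alt_shift r w i \<in> \<int>"
proof -
  have "1 \<le> i" using assms by simp
  then show ?thesis
    using assms(4)
  proof (induction rule: dec_induct)
    case base
    then show ?case using assms by (simp add: alt_shift_def)
  next
    case (step m)
    have "w m + w (Suc m) \<in> \<int>"
      using assms(2)[of "Suc m"] step by (auto simp: lookup_edge_comb[OF assms(1)] split: if_splits)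
    moreover have "alt_shift r w (Suc m) = (w m + w (Suc m)) - alt_shift r w m"
      by (auto simp: alt_shift_def)
    ultimately show ?case
      using step by (metis Ints_diff Suc_leD Suc_le_eq atLeastAtMost_iff)
  qed
qed

section \<open>The real cone\<close>

text \<open>
  This is the dilate \<open>t P\<close> of the polytope. The inequalities replace the convex combinations of
  the two endpoints of each vertical unit segment: besides \<open>a w\<^sub>1\<close>, the height receives the total
  weight of the upper endpoints, which is any number between \<open>0\<close> and \<open>t\<close>.
\<close>

definition real_slice :: "nat \<Rightarrow> nat \<Rightarrow> real \<Rightarrow> space set" where
  "real_slice k a t = {(edge_comb k w, h) | w h.
     (\<forall>i\<in>{1..2 * k}. 0 \<le> w i) \<and> sum w {1..2 * k} = t \<and> a * w 1 \<le> h \<and> h \<le> a * w 1 + t}"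

lemma convex_real_slice: "convex (real_slice k a 1)"
proof (rule convexI)
  fix p q :: space and u v :: real
  assume pq: "p \<in> real_slice k a 1" "q \<in> real_slice k a 1" and uv: "0 \<le> u" "0 \<le> v" "u + v = 1"
  obtain w :: "nat \<Rightarrow> real" and h :: real where p: "p = (edge_comb k w, h)" "\<forall>i\<in>{1..2 * k}. 0 \<le> w i" "sum w {1..2 * k} = 1"
      "a * w 1 \<le> h" "h \<le> a * w 1 + 1"
    using pq(1) by (auto simp: real_slice_def)
  obtain w' :: "nat \<Rightarrow> real" and h' :: real where q: "q = (edge_comb k w', h')" "\<forall>i\<in>{1..2 * k}. 0 \<le> w' i"
      "sum w' {1..2 * k} = 1" "a * w' 1 \<le> h'" "h' \<le> a * w' 1 + 1"
    using pq(2) by (auto simp: real_slice_def)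
  define z where "z = (\<lambda>i. u * w i + v * w' i)"
  have "u *\<^sub>R p + v *\<^sub>R q = (edge_comb k z, u * h + v * h')"
    unfolding z_def edge_comb_add edge_comb_scale by (simp add: p q)
  moreover have "\<forall>i\<in>{1..2 * k}. 0 \<le> z i"
    using p q uv by (simp add: z_def)
  moreover have "sum z {1..2 * k} = 1"
    using p q uv by (simp add: z_def sum.distrib flip: sum_distrib_left)
  moreover have "u * (a * w 1) \<le> u * h" "u * h \<le> u * (a * w 1 + 1)"
      "v * (a * w' 1) \<le> v * h'" "v * h' \<le> v * (a * w' 1 + 1)"
    using p q uv by (auto intro: mult_left_mono)
  then have "a * z 1 \<le> u * h + v * h'" "u * h + v * h' \<le> a * z 1 + 1"
    using uv by (auto simp: z_def algebra_simps)
  ultimately show "u *\<^sub>R p + v *\<^sub>R q \<in> real_slice k a 1"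
    by (auto simp: real_slice_def)
qed

definition edge_height :: "nat \<Rightarrow> nat \<Rightarrow> nat" where
  "edge_height a i = (if i = 1 then a else 0)"

text \<open>
  A point at relative height \<open>s = h - a w\<^sub>1\<close> is the combination, with weights \<open>w\<close>, of the points at
  relative height \<open>s\<close> on the \<open>2 k\<close> vertical edges of the polytope.
\<close>

lemma cycle_polytope_eq:
  assumes "k \<ge> 2"
  shows "cycle_polytope k a = real_slice k a 1"
proof
  define V where "V = (\<Union>i\<in>{2..2 * k}. {(edge_vector (cycle_edge k i), 0::real),
      (edge_vector (cycle_edge k i), 1)}) \<union>
      {(edge_vector (cycle_edge k 1), real a), (edge_vector (cycle_edge k 1), real a + 1)}"
  have P: "cycle_polytope k a = convex hull V"
    by (simp add: cycle_polytope_def V_def)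
  have "(edge_vector (cycle_edge k i), real (edge_height a i) + s) \<in> real_slice k a 1"
    if "i \<in> {1..2 * k}" "s \<in> {0, 1}" for i s
    unfolding real_slice_def using that edge_comb_delta[OF that(1)]
    by (intro CollectI exI[of _ "\<lambda>l. if l = i then 1 else 0"] exI[of _ "real (edge_height a i) + s"])
       (auto simp: edge_height_def)
  note vertex = this
  have "(edge_vector (cycle_edge k i), s) \<in> real_slice k a 1" if "i \<in> {2..2 * k}" "s \<in> {0, 1}" for i s
    using vertex[of i s] that by (auto simp: edge_height_def)
  then have "V \<subseteq> real_slice k a 1"
    using vertex[of 1 0] vertex[of 1 1] assms by (auto simp: V_def edge_height_def)
  then show "cycle_polytope k a \<subseteq> real_slice k a 1"
    unfolding P by (intro hull_minimal convex_real_slice)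
  show "real_slice k a 1 \<subseteq> cycle_polytope k a"
  proof
    fix p assume "p \<in> real_slice k a 1"
    then obtain w :: "nat \<Rightarrow> real" and h :: real where p: "p = (edge_comb k w, h)" "\<forall>i\<in>{1..2 * k}. 0 \<le> w i"
        "sum w {1..2 * k} = 1" "a * w 1 \<le> h" "h \<le> a * w 1 + 1"
      by (auto simp: real_slice_def)
    define s where "s = h - a * w 1"
    define b where "b i = (edge_vector (cycle_edge k i), real (edge_height a i) + s)" for i
    have "b i \<in> convex hull V" if "i \<in> {1..2 * k}" for i
    proof -
      define b0 where "b0 = (edge_vector (cycle_edge k i), real (edge_height a i))"
      define b1 where "b1 = (edge_vector (cycle_edge k i), real (edge_height a i) + 1)"
      have V: "b0 \<in> V" "b1 \<in> V"
        using that by (auto simp: b0_def b1_def V_def edge_height_def)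
      then have "b0 \<in> convex hull V" "b1 \<in> convex hull V"
        by (auto intro: hull_inc)
      then have "(1 - s) *\<^sub>R b0 + s *\<^sub>R b1 \<in> convex hull V"
        using p by (intro convexD[OF convex_convex_hull]) (auto simp: s_def)
      also have "(1 - s) *\<^sub>R b0 + s *\<^sub>R b1 = b i"
        by (simp add: b0_def b1_def b_def algebra_simps)
      finally show ?thesis .
    qed
    then have "(\<Sum>i\<in>{1..2 * k}. w i *\<^sub>R b i) \<in> convex hull V"
      using p by (intro convex_sum) auto
    also have "(\<Sum>i\<in>{1..2 * k}. w i *\<^sub>R b i) = p"
    proof (rule prod_eqI)
      have "snd (\<Sum>i\<in>{1..2 * k}. w i *\<^sub>R b i) =
          (\<Sum>i\<in>{1..2 * k}. (if i = 1 then a * w i else 0) + w i * s)"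
        by (auto simp: snd_sum b_def edge_height_def algebra_simps intro!: sum.cong)
      also have "\<dots> = a * w 1 + s"
        using assms p by (simp add: sum.distrib flip: sum_distrib_right)
      finally show "snd (\<Sum>i\<in>{1..2 * k}. w i *\<^sub>R b i) = snd p"
        by (simp add: s_def p)
    qed (simp add: fst_sum p edge_comb_def b_def)
    finally show "p \<in> cycle_polytope k a"
      unfolding P .
  qed
qed

lemma real_slice_scale:
  assumes "t > 0"
  shows "real_slice k a t = (\<lambda>p. t *\<^sub>R p) ` real_slice k a 1"
proof -
  have scale: "r *\<^sub>R p \<in> real_slice k a (r * t)"
    if r: "r > 0" and slice: "p \<in> real_slice k a t" for r t p
  proof -
    obtain w :: "nat \<Rightarrow> real" and h :: real where p: "p = (edge_comb k w, h)" "\<forall>i\<in>{1..2 * k}. 0 \<le> w i"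
        "sum w {1..2 * k} = t" "a * w 1 \<le> h" "h \<le> a * w 1 + t"
      using slice by (auto simp: real_slice_def)
    have "r *\<^sub>R p = (edge_comb k (\<lambda>i. r * w i), r * h)"
      by (simp add: p edge_comb_scale)
    moreover have "r * (a * w 1) \<le> r * h" "r * h \<le> r * (a * w 1 + t)"
      using p r by (auto intro: mult_left_mono)
    ultimately show ?thesis
      using p r unfolding real_slice_def
      by (intro CollectI exI[of _ "\<lambda>i. r * w i"] exI[of _ "r * h"])
         (auto simp: algebra_simps simp flip: sum_distrib_left)
  qed
  show ?thesis
  proof (intro equalityI subsetI)
    fix p assume "p \<in> real_slice k a t"
    then have "inverse t *\<^sub>R p \<in> real_slice k a 1"
      using scale[of "inverse t" p t] assms by simp
    then show "p \<in> (\<lambda>p. t *\<^sub>R p) ` real_slice k a 1"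
      using assms by (intro image_eqI[of _ _ "inverse t *\<^sub>R p"]) auto
  next
    fix p assume "p \<in> (\<lambda>p. t *\<^sub>R p) ` real_slice k a 1"
    then show "p \<in> real_slice k a t"
      using scale[of t _ 1] assms by auto
  qed
qed

lemma cone_slice_eq:
  assumes "k \<ge> 2" "j \<ge> 1"
  shows "{c \<in> cone_semigroup (cycle_lattice k) (cycle_polytope k a). fst c = real j} =
    {real j} \<times> (cycle_lattice k \<inter> real_slice k a (real j))"
proof -
  have "(real j, p) \<in> cone hull ({1} \<times> cycle_polytope k a) \<longleftrightarrow>
      (\<exists>q\<in>real_slice k a 1. p = real j *\<^sub>R q)" (is "?L p \<longleftrightarrow> ?R p") for p
  proof
    assume "?L p"
    then obtain r q where "(real j, p) = r *\<^sub>R (1, q)" "q \<in> real_slice k a 1"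
      unfolding cone_hull_expl cycle_polytope_eq[OF assms(1)] by blast
    then show "?R p" by (intro bexI[of _ q]) auto
  next
    assume "?R p"
    then obtain q where "q \<in> real_slice k a 1" "p = real j *\<^sub>R q" by blast
    then show "?L p"
      using mem_cone_hull[of "(1 :: real, q)" "{1} \<times> cycle_polytope k a" "real j"]
      by (simp add: cycle_polytope_eq[OF assms(1)])
  qed
  then have "(real j, p) \<in> cone hull ({1} \<times> cycle_polytope k a) \<longleftrightarrow>
      p \<in> real_slice k a (real j)" for p
    using assms by (simp only: real_slice_scale[of "real j"] image_iff)
  then show ?thesis
    by (auto simp: cone_semigroup_def)
qed

section \<open>The generated semigroup\<close>

definition multiplicities :: "nat \<Rightarrow> nat \<Rightarrow> (nat \<Rightarrow> nat) set" where
  "multiplicities k j = {n. (\<forall>i. i \<notin> {1..2 * k} \<longrightarrow> n i = 0) \<and> sum n {1..2 * k} = j}"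

definition lattice_point :: "nat \<Rightarrow> nat \<Rightarrow> (nat \<Rightarrow> nat) \<Rightarrow> nat \<Rightarrow> space" where
  "lattice_point k a n s = (edge_comb k (\<lambda>i. real (n i)), real (a * n 1 + s))"

lemma lattice_point_in_cycle_lattice:
  assumes "k \<ge> 2"
  shows "lattice_point k a n s \<in> cycle_lattice k"
  using assms
  by (auto simp: lattice_point_def cycle_lattice_def lookup_edge_comb in_keys_iff split: if_splits)

lemma lattice_point_in_real_slice:
  assumes "n \<in> multiplicities k j" "s \<le> j"
  shows "lattice_point k a n s \<in> real_slice k a (real j)"
  using assms unfolding lattice_point_def real_slice_def multiplicities_def
  by (intro CollectI exI[of _ "\<lambda>i. real (n i)"] exI[of _ "real (a * n 1 + s)"])
     (auto simp flip: of_nat_sum)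

text \<open>
  These are the multiplicities \<open>n\<close> whose shift by \<open>-1\<close> is again nonnegative, that is, for which both
  \<open>n\<^sub>1\<close> and \<open>n\<^sub>1 + 1\<close> occur as the first weight of the same vertex vector.
\<close>

definition even_positive :: "nat \<Rightarrow> nat \<Rightarrow> (nat \<Rightarrow> nat) set" where
  "even_positive k j = {n \<in> multiplicities k j. \<forall>i\<in>{1..2 * k}. even i \<longrightarrow> n i \<ge> 1}"

text \<open>
  Given real weights, round the first one down to \<open>n\<^sub>1\<close>; then \<open>h = a n\<^sub>1 + s\<close> with \<open>s \<ge> 0\<close>.
  For \<open>s \<le> j\<close> this is a natural description. Otherwise the first weight was not an integer, so
  the even weights strictly increased and are positive; hence one can also round up. For \<open>s \<ge> a\<close>
  rounding up gives a natural description, and the remaining \<open>s\<close> are the gaps.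
\<close>

lemma real_slice_lattice_cases:
  assumes "k \<ge> 2" "p \<in> cycle_lattice k" "p \<in> real_slice k a (real j)"
  obtains (generated) n s where "n \<in> multiplicities k j" "s \<le> j" "p = lattice_point k a n s"
  | (gap) n s where "n \<in> even_positive k j" "j < s" "s < a" "p = lattice_point k a n s"
proof -
  obtain w :: "nat \<Rightarrow> real" and h :: real where w: "p = (edge_comb k w, h)" "\<forall>i\<in>{1..2 * k}. 0 \<le> w i"
      "sum w {1..2 * k} = real j" "a * w 1 \<le> h" "h \<le> a * w 1 + real j"
    using assms by (auto simp: real_slice_def)
  have x: "Poly_Mapping.lookup (edge_comb k w) v \<in> \<int>" and h: "h \<in> \<int>" for v
    using assms(2) by (auto simp: cycle_lattice_def w)
  \<comment> \<open>\<open>n\<close> is the result of rounding the first weight down.\<close>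
  define d where "d = frac (w 1)"
  have d: "0 \<le> d" "d < 1" "w 1 - d \<in> \<int>"
    by (simp_all add: d_def frac_lt_1) (simp add: frac_def)
  define n where "n i = (if i \<in> {1..2 * k} then nat \<lfloor>alt_shift d w i\<rfloor> else 0)" for i
  have n: "real (n i) = alt_shift d w i" if i: "i \<in> {1..2 * k}" for i
  proof -
    have "alt_shift d w i \<in> \<int>"
      using integral_edge_comb_imp_alt_shift[OF assms(1) x d(3) i] .
    then obtain z where z: "alt_shift d w i = of_int z"
      by (auto elim: Ints_cases)
    have "w i \<ge> 0" using w i by simp
    then have "alt_shift d w i > -1"
      using d by (auto simp: alt_shift_def)
    then have "z \<ge> 0" unfolding z by linarith
    then show ?thesis
      using i z by (simp add: n_def)
  qed
  have comb_n: "edge_comb k (\<lambda>i. real (n i)) = edge_comb k w"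
    using edge_comb_cong[of k "\<lambda>i. real (n i)" "alt_shift d w"] n
      edge_comb_alt_shift[OF assms(1)] by simp
  have "real (sum n {1..2 * k}) = sum (alt_shift d w) {1..2 * k}"
    using n by simp
  then have "sum n {1..2 * k} = j"
    unfolding sum_alt_shift w(3) of_nat_eq_iff .
  moreover have "\<forall>i. i \<notin> {1..2 * k} \<longrightarrow> n i = 0"
    by (simp add: n_def)
  ultimately have n_mult: "n \<in> multiplicities k j"
    by (simp add: multiplicities_def)
  have n1: "real (n 1) = w 1 - d"
    using n[of 1] assms(1) by (simp add: alt_shift_def)
  have "a * n 1 \<le> h"
  proof -
    have "a * (w 1 - d) \<le> a * w 1" using d by (intro mult_left_mono) auto
    then show ?thesis using n1 w by simp
  qed
  then obtain s where s: "h = real (a * n 1 + s)"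
  proof -
    have "h - a * n 1 \<in> \<int>" using h by auto
    then obtain z where "h - a * n 1 = of_int z" by (elim Ints_cases)
    then show ?thesis using \<open>a * n 1 \<le> h\<close> by (intro that[of "nat z"]) auto
  qed
  have p: "p = lattice_point k a n s"
    by (simp add: lattice_point_def comb_n s w)
  show thesis
  proof (cases "s \<le> j")
    case True
    then show thesis using generated n_mult p by blast
  next
    case False
    have "d > 0"
    proof (rule ccontr)
      assume "\<not> d > 0"
      then have "real (n 1) = w 1" using d n1 by simp
      then show False using w(5) False unfolding s by auto
    qed
    have pos: "n i \<ge> 1" if "i \<in> {1..2 * k}" "even i" for i
    proof -
      have "real (n i) > 0"
        using n[OF that(1)] that w(2) \<open>d > 0\<close> by (simp add: alt_shift_def add_nonneg_pos)
      then show ?thesis by simp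
    qed
    show thesis
    proof (cases "s < a")
      case True
      have "n \<in> even_positive k j" using n_mult pos by (simp add: even_positive_def)
      then show thesis using gap[of n s] True False p by simp
    next
      case s_ge: False
      \<comment> \<open>\<open>m\<close> is the result of rounding the first weight up.\<close>
      define m where "m i = (if i \<in> {1..2 * k} then if odd i then n i + 1 else n i - 1 else 0)" for i
      have m: "real (m i) = alt_shift (-1) (\<lambda>i. real (n i)) i" if "i \<in> {1..2 * k}" for i
        using that pos[OF that] by (auto simp: m_def alt_shift_def)
      have comb_m: "edge_comb k (\<lambda>i. real (m i)) = edge_comb k w"
        using edge_comb_cong[of k "\<lambda>i. real (m i)" "alt_shift (-1) (\<lambda>i. real (n i))"] m
          edge_comb_alt_shift[OF assms(1)] comb_n by simp
      have "real (sum m {1..2 * k}) = sum (alt_shift (-1) (\<lambda>i. real (n i))) {1..2 * k}"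
        using m by simp
      also have "\<dots> = real (sum n {1..2 * k})"
        unfolding sum_alt_shift by simp
      finally have "sum m {1..2 * k} = sum n {1..2 * k}"
        unfolding of_nat_eq_iff .
      then have "m \<in> multiplicities k j"
        using n_mult by (simp add: multiplicities_def) (simp add: m_def)
      moreover have m1: "m 1 = n 1 + 1"
        using assms(1) by (simp add: m_def)
      have "s - a \<le> j"
      proof -
        have "a * w 1 \<le> a * (real (n 1) + 1)"
          using d n1 by (intro mult_left_mono) auto
        then have "real s \<le> real a + real j"
          using w(5) unfolding s by (simp add: algebra_simps)
        then show ?thesis by linarith
      qed
      moreover have "p = lattice_point k a m (s - a)"
        using s_ge m1 by (simp add: lattice_point_def comb_m s w algebra_simps)
      ultimately show thesis using generated by blast
    qed
  qed
qed

lemma even_positive_imp_le: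
  assumes "n \<in> even_positive k j"
  shows "k \<le> j"
proof -
  have "k = (\<Sum>i\<in>{1..2 * k}. if even i then 1 else 0 :: nat)"
    by (induction k) auto
  also have "\<dots> \<le> sum n {1..2 * k}"
    using assms by (intro sum_mono) (auto simp: even_positive_def)
  finally show ?thesis
    using assms by (simp add: even_positive_def multiplicities_def)
qed

lemma lattice_point_add:
  "lattice_point k a (\<lambda>i. n i + n' i) (s + s') = lattice_point k a n s + lattice_point k a n' s'"
  by (simp add: lattice_point_def edge_comb_add algebra_simps)

lemma lattice_point_generated:
  assumes "k \<ge> 2" "n \<in> multiplicities k j" "s \<le> j"
  shows "(real j, lattice_point k a n s) \<in>
    generated_semigroup ((\<int> \<times> cycle_lattice k) \<inter> ({1} \<times> cycle_polytope k a))"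
    (is "_ \<in> generated_semigroup ?G")
  using assms(2,3)
proof (induction j arbitrary: n s)
  case 0
  then have "n i = 0" for i by (cases "i \<in> {1..2 * k}") (auto simp: multiplicities_def)
  then have "n = (\<lambda>i. 0)" by blast
  then have "(real 0, lattice_point k a n s) = 0"
    using 0 by (simp add: lattice_point_def edge_comb_def zero_prod_def)
  then show ?case by (metis generated_semigroup.zero)
next
  case (Suc j)
  have "sum n {1..2 * k} > 0" using Suc.prems by (simp add: multiplicities_def)
  then obtain i where i: "i \<in> {1..2 * k}" "n i > 0"
    by (metis gr_zeroI less_numeral_extra(3) sum.neutral)
  define e where "e l = (if l = i then 1 else 0 :: nat)" for l
  define m where "m l = n l - e l" for l
  have split: "n = (\<lambda>l. m l + e l)"
    using i by (auto simp: m_def e_def)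
  have e: "e \<in> multiplicities k 1"
    using i by (auto simp: multiplicities_def e_def)
  have "sum n {1..2 * k} = sum m {1..2 * k} + sum e {1..2 * k}"
    by (subst split) (simp add: sum.distrib)
  then have m: "m \<in> multiplicities k j"
    using Suc.prems e by (auto simp: multiplicities_def m_def)
  \<comment> \<open>The generator split off takes one unit of the excess height \<open>s\<close> whenever there is one,
    so the remaining excess stays within the degree.\<close>
  define t where "t = min 1 s"
  have "(1, lattice_point k a e t) \<in> ?G"
    using lattice_point_in_cycle_lattice[OF assms(1)] lattice_point_in_real_slice[OF e, of t a]
    by (simp add: cycle_polytope_eq[OF assms(1)] t_def)
  moreover have "s - t \<le> j" using Suc.prems by (auto simp: t_def)
  ultimately have "(real j, lattice_point k a m (s - t)) + (1, lattice_point k a e t) \<in>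
      generated_semigroup ?G"
    by (rule generated_semigroup.add[OF Suc.IH[OF m] generated_semigroup.gen, rotated])
  also have "(real j, lattice_point k a m (s - t)) + (1, lattice_point k a e t) =
      (real (Suc j), lattice_point k a n s)"
    by (subst split) (simp add: t_def flip: lattice_point_add)
  finally show ?case .
qed

text \<open>
  A lattice point of the polytope could only fail to be of this form if it were a gap in degree
  one, but gaps need at least \<open>k \<ge> 2\<close> edges.
\<close>

lemma generated_imp_lattice_point:
  assumes "k \<ge> 2"
    and "c \<in> generated_semigroup ((\<int> \<times> cycle_lattice k) \<inter> ({1} \<times> cycle_polytope k a))"
  shows "\<exists>j n s. n \<in> multiplicities k j \<and> s \<le> j \<and> c = (real j, lattice_point k a n s)"
  using assms(2)
proof induction
  case zero
  have "0 = (real 0, lattice_point k a (\<lambda>_. 0) 0)"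
    by (simp add: lattice_point_def edge_comb_def zero_prod_def)
  moreover have "(\<lambda>_. 0) \<in> multiplicities k 0" by (simp add: multiplicities_def)
  ultimately show ?case by blast
next
  case (gen c)
  then obtain p where c: "c = (1, p)" "p \<in> cycle_lattice k" "p \<in> real_slice k a (real 1)"
    by (auto simp: cycle_polytope_eq[OF assms(1)])
  from assms(1) c(2,3) show ?case
  proof (cases rule: real_slice_lattice_cases)
    case (generated n s)
    then show ?thesis using c(1) by (intro exI[of _ 1]) auto
  next
    case (gap n s)
    then show ?thesis using even_positive_imp_le assms(1) by fastforce
  qed
next
  case (add c c')
  then obtain j n s j' n' s' where
    "n \<in> multiplicities k j" "s \<le> j" "c = (real j, lattice_point k a n s)"
    "n' \<in> multiplicities k j'" "s' \<le> j'" "c' = (real j', lattice_point k a n' s')"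
    by blast
  then show ?case
    by (intro exI[of _ "j + j'"] exI[of _ "\<lambda>i. n i + n' i"] exI[of _ "s + s'"])
       (auto simp: lattice_point_add multiplicities_def sum.distrib)
qed

lemma generated_slice_eq:
  assumes "k \<ge> 2"
  shows "{c \<in> generated_semigroup ((\<int> \<times> cycle_lattice k) \<inter> ({1} \<times> cycle_polytope k a)).
      fst c = real j} =
    {real j} \<times> (\<lambda>(n, s). lattice_point k a n s) ` (multiplicities k j \<times> {0..j})"
proof (intro equalityI subsetI)
  fix c
  assume "c \<in> {c \<in> generated_semigroup ((\<int> \<times> cycle_lattice k) \<inter> ({1} \<times> cycle_polytope k a)).
      fst c = real j}"
  then obtain n s where "n \<in> multiplicities k j" "s \<le> j" "c = (real j, lattice_point k a n s)"
    using generated_imp_lattice_point[OF assms, of c a] by auto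
  then show "c \<in> {real j} \<times> (\<lambda>(n, s). lattice_point k a n s) ` (multiplicities k j \<times> {0..j})"
    by auto
qed (use lattice_point_generated[OF assms] in auto)

section \<open>Counting the gaps\<close>

lemma finite_multiplicities: "finite (multiplicities k j)"
  and card_multiplicities: "k \<ge> 1 \<Longrightarrow> card (multiplicities k j) = (j + 2 * k - 1) choose (2 * k - 1)"
proof -
  define L where "L = {l::nat list. length l = 2 * k \<and> sum_list l = j}"
  have bij: "bij_betw (\<lambda>n. map n [1..<Suc (2 * k)]) (multiplicities k j) L"
  proof (rule bij_betw_byWitness[of _ "\<lambda>l i. if i \<in> {1..2 * k} then l ! (i - 1) else 0"])
    show "\<forall>n\<in>multiplicities k j.
        (\<lambda>i. if i \<in> {1..2 * k} then map n [1..<Suc (2 * k)] ! (i - 1) else 0) = n"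
      by (auto simp: multiplicities_def fun_eq_iff simp del: upt_Suc)
    show "\<forall>l\<in>L. map (\<lambda>i. if i \<in> {1..2 * k} then l ! (i - 1) else 0) [1..<Suc (2 * k)] = l"
      by (auto simp: L_def intro!: nth_equalityI simp del: upt_Suc)
    show "(\<lambda>n. map n [1..<Suc (2 * k)]) ` multiplicities k j \<subseteq> L"
      by (auto simp: L_def multiplicities_def interv_sum_list_conv_sum_set_nat
            atLeastLessThanSuc_atLeastAtMost simp del: upt_Suc)
    show "(\<lambda>l i. if i \<in> {1..2 * k} then l ! (i - 1) else 0) ` L \<subseteq> multiplicities k j"
    proof -
      have "(\<Sum>i\<in>{1..2 * k}. l ! (i - 1)) = sum_list l" if "length l = 2 * k" for l :: "nat list"
        using that sum.shift_bounds_Suc_ivl[of "\<lambda>i. l ! (i - 1)" 0 "2 * k"]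
        by (simp add: sum_list_sum_nth atLeastLessThanSuc_atLeastAtMost)
      then show ?thesis by (auto simp: multiplicities_def L_def)
    qed
  qed
  have "L \<subseteq> {l. set l \<subseteq> {0..j} \<and> length l = 2 * k}"
    by (auto simp: L_def member_le_sum_list)
  then have "finite L"
    by (rule finite_subset) (simp add: finite_lists_length_eq)
  then show "finite (multiplicities k j)"
    using bij bij_betw_finite by blast
  show "card (multiplicities k j) = (j + 2 * k - 1) choose (2 * k - 1)" if "k \<ge> 1"
  proof -
    have "card (multiplicities k j) = (j + 2 * k - 1) choose j"
      using bij_betw_same_card[OF bij] card_length_sum_list[of "2 * k" j] by (simp add: L_def)
    also have "\<dots> = (j + 2 * k - 1) choose (j + 2 * k - 1 - j)"
      using that by (intro binomial_symmetric) simp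
    finally show ?thesis using that by simp
  qed
qed

lemma card_even_positive:
  assumes "k \<ge> 1" "k \<le> j"
  shows "card (even_positive k j) = (j + k - 1) choose (2 * k - 1)"
proof -
  define e where "e i = (if i \<in> {1..2 * k} \<and> even i then 1 else 0 :: nat)" for i
  have sum_e: "sum e {1..2 * k} = k"
  proof -
    have "sum e {1..2 * k} = (\<Sum>i\<in>{1..2 * k}. if even i then 1 else 0 :: nat)"
      by (intro sum.cong) (auto simp: e_def)
    also have "\<dots> = k" by (induction k) auto
    finally show ?thesis .
  qed
  have "bij_betw (\<lambda>n i. n i + e i) (multiplicities k (j - k)) (even_positive k j)"
  proof (rule bij_betw_byWitness[of _ "\<lambda>n i. n i - e i"])
    show "(\<lambda>n i. n i + e i) ` multiplicities k (j - k) \<subseteq> even_positive k j"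
      using assms sum_e
      by (auto simp: even_positive_def multiplicities_def sum.distrib) (auto simp: e_def)
    show "(\<lambda>n i. n i - e i) ` even_positive k j \<subseteq> multiplicities k (j - k)"
    proof -
      have "(\<Sum>i\<in>{1..2 * k}. n i - e i) = j - k" if "n \<in> even_positive k j" for n
        using that sum_e
        by (subst sum_subtractf_nat) (auto simp: even_positive_def multiplicities_def e_def)
      then show ?thesis by (auto simp: even_positive_def multiplicities_def)
    qed
  qed (auto simp: even_positive_def e_def fun_eq_iff)
  from bij_betw_same_card[OF this] show ?thesis
    using card_multiplicities[OF assms(1), of "j - k"] assms by (simp add: add.commute)
qed

text \<open>
  Both remainders are below \<open>a\<close>, so division of the height by \<open>a\<close> recovers the first multiplicity.
\<close>

lemma lattice_point_not_generated:
  assumes "k \<ge> 2" "n' \<in> multiplicities k j" "s' \<le> j" "j < s" "s < a"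
  shows "lattice_point k a n s \<noteq> lattice_point k a n' s'"
proof
  assume "lattice_point k a n s = lattice_point k a n' s'"
  then have "real (a * n 1 + s) = real (a * n' 1 + s')"
    by (simp add: lattice_point_def)
  then have h: "a * n 1 + s = a * n' 1 + s'"
    by linarith
  then have "(a * n 1 + s) div a = (a * n' 1 + s') div a" by simp
  then have "n 1 = n' 1" using assms by simp
  then show False using h assms by simp
qed

text \<open>
  Moving the fraction \<open>s / a\<close> of the way from the first weight \<open>n\<^sub>1\<close> to \<open>n\<^sub>1 + 1\<close> raises \<open>a w\<^sub>1\<close> to the
  height of the point; positivity of the even multiplicities keeps the weights nonnegative.
\<close>

lemma even_positive_point_in_real_slice:
  assumes "k \<ge> 2" "n \<in> even_positive k j" "s < a"
  shows "lattice_point k a n s \<in> real_slice k a (real j)"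
proof -
  define d where "d = s / a"
  have d: "0 \<le> d" "d \<le> 1" "a * d = s" using assms by (auto simp: d_def)
  define w where "w = alt_shift (- d) (\<lambda>i. real (n i))"
  have "lattice_point k a n s = (edge_comb k w, real (a * n 1 + s))"
    by (simp add: lattice_point_def w_def edge_comb_alt_shift[OF assms(1)])
  moreover have "0 \<le> w i" if "i \<in> {1..2 * k}" for i
  proof (cases "even i")
    case True
    then have "real (n i) \<ge> 1" using assms that by (simp add: even_positive_def)
    then show ?thesis using d by (simp add: w_def alt_shift_def)
  qed (use d in \<open>simp add: w_def alt_shift_def\<close>)
  moreover have "sum w {1..2 * k} = real j"
    using assms unfolding w_def sum_alt_shift
    by (auto simp: even_positive_def multiplicities_def simp flip: of_nat_sum)
  moreover have "a * w 1 = real (a * n 1 + s)"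
    using d by (simp add: w_def alt_shift_def algebra_simps)
  ultimately show ?thesis
    by (auto simp: real_slice_def)
qed

text \<open>
  The first multiplicity is the quotient of the height by \<open>a\<close>, and together with the vertex vector
  it determines all the others.
\<close>

lemma inj_on_even_positive_point:
  assumes "k \<ge> 2"
  shows "inj_on (\<lambda>(n, s). lattice_point k a n s) (even_positive k j \<times> {j<..<a})"
proof (rule inj_onI, clarify)
  fix n s n' s'
  assume n: "n \<in> even_positive k j" "n' \<in> even_positive k j"
    and s: "s \<in> {j<..<a}" "s' \<in> {j<..<a}"
    and eq: "lattice_point k a n s = lattice_point k a n' s'"
  have "real (a * n 1 + s) = real (a * n' 1 + s')"
    using eq by (simp add: lattice_point_def)
  then have h: "a * n 1 + s = a * n' 1 + s'" by linarith
  then have "(a * n 1 + s) div a = (a * n' 1 + s') div a" by simp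
  then have n1: "n 1 = n' 1" using s by simp
  then have "s = s'" using h by simp
  have "n i = n' i" for i
  proof (cases "i \<in> {1..2 * k}")
    case True
    have "edge_comb k (\<lambda>i. real (n i)) = edge_comb k (\<lambda>i. real (n' i))"
      using eq by (simp add: lattice_point_def)
    from edge_comb_eq_imp_alt_shift[OF assms this True] show ?thesis
      using n1 by (simp add: alt_shift_def split: if_splits)
  next
    case False
    then show ?thesis using n by (simp add: even_positive_def multiplicities_def)
  qed
  then show "n = n' \<and> s = s'" using \<open>s = s'\<close> by auto
qed

lemma gap_vector_eq_card_even_positive:
  assumes "k \<ge> 2" "j \<ge> 1"
  shows "gap_vector (cycle_lattice k) (cycle_polytope k a) j =
    int (card (even_positive k j)) * int (card {j<..<a})"
proof -
  define f where "f = (\<lambda>(n, s). lattice_point k a n s)"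
  define C where "C = cycle_lattice k \<inter> real_slice k a (real j)"
  define S where "S = f ` (multiplicities k j \<times> {0..j})"
  define D where "D = f ` (even_positive k j \<times> {j<..<a})"
  have "C \<subseteq> S \<union> D"
  proof
    fix p assume "p \<in> C"
    then have "p \<in> cycle_lattice k" "p \<in> real_slice k a (real j)" by (auto simp: C_def)
    with assms(1) show "p \<in> S \<union> D"
      by (cases rule: real_slice_lattice_cases) (auto simp: S_def D_def f_def)
  qed
  moreover have "S \<union> D \<subseteq> C"
    using lattice_point_in_cycle_lattice[OF assms(1)] lattice_point_in_real_slice
      even_positive_point_in_real_slice[OF assms(1)]
    by (auto simp: S_def D_def C_def f_def)
  moreover have "S \<inter> D = {}"
    using lattice_point_not_generated[OF assms(1)] by (fastforce simp: S_def D_def f_def)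
  moreover have "finite S"
    by (simp add: S_def finite_multiplicities)
  moreover have "finite D"
    using finite_multiplicities by (auto simp: D_def even_positive_def)
  ultimately have "card C = card S + card D"
    by (metis card_Un_disjoint subset_antisym)
  moreover have "card D = card (even_positive k j) * card {j<..<a}"
    unfolding D_def f_def by (simp add: card_image[OF inj_on_even_positive_point[OF assms(1)]] card_cartesian_product)
  moreover have "Ehr (cycle_lattice k) (cycle_polytope k a) j = card C"
    unfolding Ehr_def cone_slice_eq[OF assms] C_def by (simp add: card_cartesian_product_singleton)
  moreover have "Hilb (cycle_lattice k) (cycle_polytope k a) j = card S"
    unfolding Hilb_def generated_slice_eq[OF assms(1)] S_def f_def
    by (simp add: card_cartesian_product_singleton)
  ultimately show ?thesis
    by (simp add: gap_vector_def)
qed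

theorem theorem12:
  fixes k a i :: nat
  assumes "k \<ge> 2" and "i \<ge> 1"
  shows "gap_vector (cycle_lattice k) (cycle_polytope k a) i =
    (if i < k \<or> int a - 2 < int i then 0
     else (int a - int i - 1) * int ((i + k - 1) choose (2 * k - 1)))"
proof (cases "i < k")
  case True
  then have "even_positive k i = {}"
    using even_positive_imp_le by fastforce
  then show ?thesis
    using True by (simp add: gap_vector_eq_card_even_positive[OF assms])
next
  case False
  then have "card (even_positive k i) = (i + k - 1) choose (2 * k - 1)"
    using assms by (intro card_even_positive) auto
  moreover have "int (card {i<..<a}) = (if int a - 2 < int i then 0 else int a - int i - 1)"
    by auto
  ultimately show ?thesis
    using False by (simp add: gap_vector_eq_card_even_positive[OF assms])
qed

end
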